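(* Let $n$ be a positive integer. The connected components of the quandle $Q\mathfrak{S}_n$ are precisely the subsets $$\Omega_{\lambda,d}:=\{(i,\sigma)\in[n]\times\mathfrak{S}_n\mid \lambda(\sigma)=\lambda\text{ and }d(i,\sigma)=d\}$$ for a partition $\lambda\vdash n$ and $d\in\mathrm{supp}(\lambda)$. In particular, there is a bijection $$\pi_0(Q\mathfrak{S}_n)\longrightarrow\bigsqcup_{\lambda\vdash n}\mathrm{supp}(\lambda)$$ given by $[(i,\sigma)]\mapsto(\lambda(\sigma),d(i,\sigma))$.
   Context: Let $[n]=\{1,\dots,n\}$ and let $\mathfrak{S}_n$ be the symmetric group on $[n]$, with permutations multiplied from left to right, so that $i^\sigma:=\sigma(i)$ is a right action. $Q\mathfrak{S}_n$ is the quandle with underlying set $[n]\times\mathfrak{S}_n$ and operation $(i,\sigma)\triangleleft(j,\tau):=(i^{\sigma^{-1}\tau},\tau^{-1}\sigma\tau)$. For a quandle $Q$ and $y\in Q$, the point symmetry $s_y(x):=x\triangleleft y$ is an automorphism; $\mathrm{Inn}(Q)$ is the group generated by all $s_y$. The connected components of $Q$ are the $\mathrm{Inn}(Q)$-orbits, $\pi_0(Q)$ is the set of connected components, and $[q]$ denotes the component containing $q$. A partition of $n$, written $\lambda=(1^{m_1}2^{m_2}\cdots n^{m_n})\vdash n$, is a sequence $(m_1,\dots,m_n)$ of non-negative integers with $\sum_k k\,m_k=n$; $\mathrm{supp}(\lambda):=\{d\in[n]\mid m_d>0\}$. The cycle type $\lambda(\sigma)$ of $\sigma\in\mathfrak{S}_n$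 is the partition $(1^{m_1}\cdots n^{m_n})$ where $m_k$ is the number of cycles of length $k$ (including fixed points for $k=1$) in the cycle decomposition of $\sigma$. For $i\in[n]$, $d(i,\sigma)$ is the length of the cycle of $\sigma$ containing $i$. *)

theory Defs
  imports
    "HOL-Algebra.Generated_Groups"
    "HOL-Algebra.Group_Action"
    "HOL-Algebra.Sym_Groups"
    "HOL-Combinatorics.Orbits"
begin

section \<open>Quandles\<close>

text \<open>The point symmetry at \<open>y\<close>, as an extensional function on the carrier \<open>Q\<close>.\<close>

definition point_symmetry :: "'a set \<Rightarrow> ('a \<Rightarrow> 'a \<Rightarrow> 'a) \<Rightarrow> 'a \<Rightarrow> ('a \<Rightarrow> 'a)" where
  "point_symmetry Q tri y = (\<lambda>x\<in>Q. tri x y)"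

locale quandle =
  fixes Q :: "'a set" and tri :: "'a \<Rightarrow> 'a \<Rightarrow> 'a"  (infixl "\<triangleleft>" 70)
  assumes closed: "\<lbrakk>x \<in> Q; y \<in> Q\<rbrakk> \<Longrightarrow> x \<triangleleft> y \<in> Q"
    and idem: "x \<in> Q \<Longrightarrow> x \<triangleleft> x = x"
    and bij: "y \<in> Q \<Longrightarrow> bij_betw (\<lambda>x. x \<triangleleft> y) Q Q"
    and self_distrib: "\<lbrakk>x \<in> Q; y \<in> Q; z \<in> Q\<rbrakk> \<Longrightarrow> (x \<triangleleft> y) \<triangleleft> z = (x \<triangleleft> z) \<triangleleft> (y \<triangleleft> z)"
begin

text \<open>Point symmetries are quandle automorphisms; in particular the generating set of \<open>Inn\<close>
  below lies in the carrier of \<open>BijGroup Q\<close>.\<close>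

lemma point_symmetry_Bij: "y \<in> Q \<Longrightarrow> point_symmetry Q tri y \<in> Bij Q"
  using bij[of y] by (simp add: point_symmetry_def Bij_def)

lemma point_symmetry_hom:
  assumes "x \<in> Q" "y \<in> Q" "z \<in> Q"
  shows "point_symmetry Q tri z (x \<triangleleft> y) = point_symmetry Q tri z x \<triangleleft> point_symmetry Q tri z y"
  using assms self_distrib[OF assms] by (simp add: point_symmetry_def closed)

end

definition Inn :: "'a set \<Rightarrow> ('a \<Rightarrow> 'a \<Rightarrow> 'a) \<Rightarrow> ('a \<Rightarrow> 'a) monoid" where
  "Inn Q tri = (BijGroup Q)\<lparr>carrier := generate (BijGroup Q) (point_symmetry Q tri ` Q)\<rparr>"

definition component :: "'a set \<Rightarrow> ('a \<Rightarrow> 'a \<Rightarrow> 'a) \<Rightarrow> 'a \<Rightarrow> 'a set" where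
  "component Q tri q = Group_Action.orbit (Inn Q tri) (\<lambda>f. f) q"

definition \<pi>\<^sub>0 :: "'a set \<Rightarrow> ('a \<Rightarrow> 'a \<Rightarrow> 'a) \<Rightarrow> 'a set set" where
  "\<pi>\<^sub>0 Q tri = component Q tri ` Q"

section \<open>The quandle on \<open>[n] \<times> S\<^sub>n\<close>\<close>

text \<open>Permutations are multiplied from left to right, and the right action is \<open>i\<^sup>\<sigma> = \<sigma> i\<close>.\<close>

definition lr_mult :: "(nat \<Rightarrow> nat) \<Rightarrow> (nat \<Rightarrow> nat) \<Rightarrow> (nat \<Rightarrow> nat)"  (infixl "\<cdot>" 70) where
  "\<sigma> \<cdot> \<tau> = \<tau> \<circ> \<sigma>"

definition QS :: "nat \<Rightarrow> (nat \<times> (nat \<Rightarrow> nat)) set" where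
  "QS n = {1..n} \<times> carrier (sym_group n)"

definition QS_op ::
  "nat \<times> (nat \<Rightarrow> nat) \<Rightarrow> nat \<times> (nat \<Rightarrow> nat) \<Rightarrow> nat \<times> (nat \<Rightarrow> nat)" where
  "QS_op = (\<lambda>(i, \<sigma>) (j, \<tau>).
     ((inv_into UNIV \<sigma> \<cdot> \<tau>) i, inv_into UNIV \<tau> \<cdot> \<sigma> \<cdot> \<tau>))"

lemma quandle_QS: "quandle (QS n) QS_op"
proof -
  define S where "S = carrier (sym_group n)"
  have S: "p \<in> S \<longleftrightarrow> p permutes {1..n}" for p
    by (simp add: S_def sym_group_def)
  have Q: "QS n = {1..n} \<times> S" by (simp add: QS_def S_def)
  have bijS: "bij p" if "p \<in> S" for p using that S permutes_bij by blast
  have invS: "inv_into UNIV p \<in> S" if "p \<in> S" for p using that S permutes_inv by blast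
  have compS: "p \<circ> q \<in> S" if "p \<in> S" "q \<in> S" for p q using that S permutes_compose by blast
  have app: "p i \<in> {1..n}" if "p \<in> S" "i \<in> {1..n}" for p i
    using that S permutes_in_image by metis
  have op: "QS_op (i, \<sigma>) (j, \<tau>) =
      (\<tau> (inv_into UNIV \<sigma> i), \<tau> \<circ> \<sigma> \<circ> inv_into UNIV \<tau>)" for i j \<sigma> \<tau>
    by (simp add: QS_op_def lr_mult_def o_assoc)
  have can1: "p (inv_into UNIV p x) = x" and can2: "inv_into UNIV p (p x) = x"
    if "p \<in> S" for p x
    using bijS[OF that] by (simp_all add: bij_is_surj surj_f_inv_f bij_is_inj)
  have invc: "inv_into UNIV (\<tau> \<circ> \<sigma> \<circ> inv_into UNIV \<tau>) =
      \<tau> \<circ> inv_into UNIV \<sigma> \<circ> inv_into UNIV \<tau>" if "\<sigma> \<in> S" "\<tau> \<in> S" for \<sigma> \<tau>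
    by (rule inv_unique_comp)
       (simp_all add: fun_eq_iff can1[OF that(1)] can1[OF that(2)] can2[OF that(1)] can2[OF that(2)])
  have closed: "QS_op x y \<in> QS n" if "x \<in> QS n" "y \<in> QS n" for x y
  proof -
    obtain i \<sigma> j \<tau> where xy: "x = (i, \<sigma>)" "y = (j, \<tau>)" by (cases x; cases y)
    have i: "i \<in> {1..n}" and \<sigma>: "\<sigma> \<in> S" and \<tau>: "\<tau> \<in> S"
      using that by (simp_all add: Q xy)
    have "\<tau> (inv_into UNIV \<sigma> i) \<in> {1..n}"
      by (rule app[OF \<tau> app[OF invS[OF \<sigma>] i]])
    moreover have "\<tau> \<circ> \<sigma> \<circ> inv_into UNIV \<tau> \<in> S"
      by (rule compS[OF compS[OF \<tau> \<sigma>] invS[OF \<tau>]])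
    ultimately show ?thesis unfolding xy op Q by (rule SigmaI)
  qed
  show ?thesis
  proof
    fix x y assume "x \<in> QS n" "y \<in> QS n"
    then show "QS_op x y \<in> QS n" by (rule closed)
  next
    fix x assume "x \<in> QS n"
    moreover obtain i \<sigma> where x: "x = (i, \<sigma>)" by (cases x)
    ultimately have "\<sigma> \<in> S" by (simp add: Q)
    then show "QS_op x x = x"
      unfolding x op by (simp add: fun_eq_iff can1)
  next
    fix y assume y: "y \<in> QS n"
    obtain j \<tau> where y': "y = (j, \<tau>)" by (cases y)
    have \<tau>: "\<tau> \<in> S" using y y' Q by auto
    have inj: "inj_on (\<lambda>x. QS_op x y) (QS n)"
    proof (rule inj_onI)
      fix a b assume a: "a \<in> QS n" and b: "b \<in> QS n" and eq: "QS_op a y = QS_op b y"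
      obtain i \<sigma> k \<rho> where ab: "a = (i, \<sigma>)" "b = (k, \<rho>)" by (cases a; cases b)
      have \<sigma>: "\<sigma> \<in> S" using a ab Q by auto
      have eq1: "\<tau> (inv_into UNIV \<sigma> i) = \<tau> (inv_into UNIV \<rho> k)"
        and eq2: "\<tau> \<circ> \<sigma> \<circ> inv_into UNIV \<tau> = \<tau> \<circ> \<rho> \<circ> inv_into UNIV \<tau>"
        using eq by (simp_all add: ab y' op)
      have inj\<tau>: "\<tau> u = \<tau> v \<Longrightarrow> u = v" for u v
        using bijS[OF \<tau>] by (simp add: bij_def inj_eq)
      have s: "\<sigma> = \<rho>"
      proof
        fix z
        have "\<tau> (\<sigma> z) = \<tau> (\<rho> z)"
          using fun_cong[OF eq2, of "\<tau> z"] by (simp add: can2[OF \<tau>])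
        then show "\<sigma> z = \<rho> z" by (rule inj\<tau>)
      qed
      have "\<sigma> (inv_into UNIV \<sigma> i) = \<sigma> (inv_into UNIV \<sigma> k)"
        using inj\<tau>[OF eq1] by (simp add: s)
      then have "i = k" by (simp only: can1[OF \<sigma>])
      then show "a = b" using s ab by simp
    qed
    have "finite (QS n)"
      by (simp add: Q S_def sym_group_def finite_permutations)
    moreover have "(\<lambda>x. QS_op x y) ` QS n \<subseteq> QS n" using closed y by blast
    ultimately show "bij_betw (\<lambda>x. QS_op x y) (QS n) (QS n)"
      using inj by (simp add: bij_betw_def endo_inj_surj)
  next
    fix x y z assume "x \<in> QS n" "y \<in> QS n" "z \<in> QS n"
    moreover obtain i \<sigma> j \<tau> k \<rho> where xyz: "x = (i, \<sigma>)" "y = (j, \<tau>)" "z = (k, \<rho>)"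
      by (cases x; cases y; cases z)
    ultimately have \<sigma>: "\<sigma> \<in> S" and \<tau>: "\<tau> \<in> S" and \<rho>: "\<rho> \<in> S" by (simp_all add: Q)
    show "QS_op (QS_op x y) z = QS_op (QS_op x z) (QS_op y z)"
      unfolding xyz op invc[OF \<sigma> \<tau>] invc[OF \<sigma> \<rho>] invc[OF \<tau> \<rho>]
      by (simp add: fun_eq_iff can2[OF \<rho>] can2[OF \<tau>])
  qed
qed

section \<open>Partitions and cycle types\<close>

text \<open>A partition \<open>(1^m\<^sub>1 2^m\<^sub>2 \<dots> n^m\<^sub>n)\<close> of \<open>n\<close> is the function \<open>k \<mapsto> m\<^sub>k\<close>, set to zero
  outside \<open>{1..n}\<close>.\<close>

definition partitions :: "nat \<Rightarrow> (nat \<Rightarrow> nat) set" where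
  "partitions n = {m. (\<forall>k. k \<notin> {1..n} \<longrightarrow> m k = 0) \<and> (\<Sum>k=1..n. k * m k) = n}"

definition supp :: "nat \<Rightarrow> (nat \<Rightarrow> nat) \<Rightarrow> nat set" where
  "supp n m = {d \<in> {1..n}. m d > 0}"

text \<open>The cycles of a permutation of \<open>{1..n}\<close> (fixed points included) are counted through their
  underlying sets, which are its orbits on \<open>{1..n}\<close>.\<close>

definition cycle_type :: "nat \<Rightarrow> (nat \<Rightarrow> nat) \<Rightarrow> (nat \<Rightarrow> nat)" where
  "cycle_type n \<sigma> = (\<lambda>k. card {C \<in> Orbits.orbit \<sigma> ` {1..n}. card C = k})"

definition cycle_length :: "nat \<Rightarrow> (nat \<Rightarrow> nat) \<Rightarrow> nat" where
  "cycle_length i \<sigma> = card (Orbits.orbit \<sigma> i)"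

definition \<Omega> :: "nat \<Rightarrow> (nat \<Rightarrow> nat) \<Rightarrow> nat \<Rightarrow> (nat \<times> (nat \<Rightarrow> nat)) set" where
  "\<Omega> n m d = {(i, \<sigma>). i \<in> {1..n} \<and> \<sigma> \<in> carrier (sym_group n)
                        \<and> cycle_type n \<sigma> = m \<and> cycle_length i \<sigma> = d}"

end

theory Submission
  imports Defs
begin

text \<open>
  Acting by \<open>(j, \<tau>)\<close> replaces \<open>(i, \<sigma>)\<close> by \<open>(\<tau> (\<sigma>\<inverse> i), \<tau> \<circ> \<sigma> \<circ> \<tau>\<inverse>)\<close>. This preserves the pair
  \<open>(\<lambda>(\<sigma>), d(i, \<sigma>))\<close>: conjugation by \<open>\<tau>\<close> carries the cycles of \<open>\<sigma>\<close> bijectively to those of the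
  conjugate, and \<open>\<sigma>\<inverse> i\<close> lies on the same cycle as \<open>i\<close>. Hence each connected component lies in some
  \<open>\<Omega>\<close>.

  Conversely, any two points \<open>(i, \<sigma>)\<close> and \<open>(k, \<rho>)\<close> with the same invariant are joined by a single
  point symmetry. Since \<open>\<sigma>\<close> and \<open>\<rho>\<close> have equally many cycles of each length, and the cycles of \<open>i\<close>
  and \<open>k\<close> have equal length, the usual cycle-matching argument gives \<open>h\<close> with
  \<open>h \<circ> \<sigma> = \<rho> \<circ> h\<close> that also satisfies \<open>h i = k\<close> (\<open>pointed_conjugator_exists\<close>). The permutation
  \<open>\<tau> = h \<circ> \<sigma>\<close> conjugates \<open>\<sigma>\<close> to \<open>\<rho>\<close> just as \<open>h\<close> does, because \<open>\<sigma>\<close> commutes with itself, and the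
  extra factor cancels the \<open>\<sigma>\<inverse>\<close> in the first coordinate: \<open>\<tau> (\<sigma>\<inverse> i) = h i = k\<close>.

  So the components are exactly the nonempty fibres of the invariant, and \<open>\<pi>\<^sub>0\<close> is in bijection with
  the set of its values. These are the pairs \<open>(\<lambda>, d)\<close> with \<open>\<lambda>\<close> a partition of \<open>n\<close> and \<open>d\<close> in its
  support, because every partition is the cycle type of some permutation
  (\<open>permutation_with_orbit_count_exists\<close>).
\<close>

section \<open>Components of a quandle and invariants\<close>

context quandle
begin

text \<open>
  Invariance passes to the inverse of a point symmetry \<open>h\<close> because \<open>c (h z) = c z\<close> can be read at
  \<open>z = h\<inverse> x\<close>; products need only composition.
\<close>

lemma Inn_preserves_invariant:
  assumes inv: "\<And>x y. x \<in> Q \<Longrightarrow> y \<in> Q \<Longrightarrow> c (x \<triangleleft> y) = c x"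
    and f: "f \<in> carrier (Inn Q tri)"
    and "x \<in> Q"
  shows "f x \<in> Q \<and> c (f x) = c x"
proof -
  interpret B: group "BijGroup Q" by (rule group_BijGroup)
  have gen: "point_symmetry Q tri ` Q \<subseteq> carrier (BijGroup Q)"
    using point_symmetry_Bij by (auto simp: BijGroup_def)
  have "f \<in> generate (BijGroup Q) (point_symmetry Q tri ` Q)"
    using f by (simp add: Inn_def)
  then show ?thesis
    using \<open>x \<in> Q\<close>
  proof (induction arbitrary: x rule: generate.induct)
    case one
    then show ?case by (simp add: BijGroup_def)
  next
    case (incl h)
    then show ?case by (auto simp: point_symmetry_def closed inv)
  next
    case (inv h)
    then obtain y where y: "y \<in> Q" "h = point_symmetry Q tri y" by blast
    have h: "h \<in> Bij Q" using y point_symmetry_Bij by blast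
    define z where "z = inv_into Q h x"
    have invh: "(inv\<^bsub>BijGroup Q\<^esub> h) x = z"
      using inv_BijGroup[OF h] inv.prems by (simp add: z_def)
    have z: "z \<in> Q" unfolding z_def by (rule Bij_inv_into_mem[OF h inv.prems])
    have "h z = x"
      using h inv.prems unfolding z_def
      by (simp add: Bij_def bij_betw_def f_inv_into_f)
    then have "z \<triangleleft> y = x" using z by (simp add: y point_symmetry_def)
    then have "c x = c z" using assms(1)[OF z y(1)] by simp
    then show ?case using invh z by simp
  next
    case (eng h1 h2)
    have "h1 \<in> Bij Q" "h2 \<in> Bij Q"
      using eng.hyps B.generate_incl[OF gen] by (auto simp: BijGroup_def)
    then have "(h1 \<otimes>\<^bsub>BijGroup Q\<^esub> h2) x = h1 (h2 x)"
      using eng.prems by (simp add: BijGroup_def compose_def)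
    then show ?case using eng.IH eng.prems by simp
  qed
qed

lemma component_eq_fibre:
  assumes inv: "\<And>x y. x \<in> Q \<Longrightarrow> y \<in> Q \<Longrightarrow> c (x \<triangleleft> y) = c x"
    and trans: "\<And>x x'. x \<in> Q \<Longrightarrow> x' \<in> Q \<Longrightarrow> c x = c x' \<Longrightarrow> \<exists>y\<in>Q. x \<triangleleft> y = x'"
    and x: "x \<in> Q"
  shows "component Q tri x = {x' \<in> Q. c x' = c x}"
proof
  show "component Q tri x \<subseteq> {x' \<in> Q. c x' = c x}"
    using Inn_preserves_invariant[of c, OF inv _ x]
    by (auto simp: component_def Group_Action.orbit_def)
next
  show "{x' \<in> Q. c x' = c x} \<subseteq> component Q tri x"
  proof
    fix x' assume "x' \<in> {x' \<in> Q. c x' = c x}"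
    then obtain y where y: "y \<in> Q" "x \<triangleleft> y = x'" using trans[OF x, of x'] by auto
    have "point_symmetry Q tri y \<in> carrier (Inn Q tri)"
      using y by (auto simp: Inn_def intro: generate.incl)
    moreover have "point_symmetry Q tri y x = x'"
      using x y by (simp add: point_symmetry_def)
    ultimately show "x' \<in> component Q tri x"
      by (auto simp: component_def Group_Action.orbit_def)
  qed
qed

end

text \<open>The bijection sends a component to the one value that the invariant takes on it.\<close>

lemma \<pi>\<^sub>0_bij_betw_invariant_values:
  assumes fibre: "\<And>q. q \<in> Q \<Longrightarrow> component Q tri q = {x \<in> Q. c x = c q}"
  shows "\<exists>F. bij_betw F (\<pi>\<^sub>0 Q tri) (c ` Q) \<and> (\<forall>q\<in>Q. F (component Q tri q) = c q)"
proof -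
  define F where "F C = the_elem (c ` C)" for C
  have F: "F (component Q tri q) = c q" if "q \<in> Q" for q
  proof -
    have "c ` component Q tri q = {c q}" using that by (auto simp: fibre)
    then show ?thesis by (simp add: F_def)
  qed
  have "bij_betw F (\<pi>\<^sub>0 Q tri) (c ` Q)"
    unfolding bij_betw_def
  proof
    show "inj_on F (\<pi>\<^sub>0 Q tri)"
      unfolding \<pi>\<^sub>0_def
    proof (rule inj_onI, elim imageE)
      fix C D q q'
      assume "F C = F D" and CD: "C = component Q tri q" "q \<in> Q" "D = component Q tri q'" "q' \<in> Q"
      then have "c q = c q'" using F by metis
      then show "C = D" using CD by (simp add: fibre)
    qed
    show "F ` \<pi>\<^sub>0 Q tri = c ` Q"
      by (simp add: \<pi>\<^sub>0_def image_image F)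
  qed
  with F show ?thesis by blast
qed

section \<open>Counting the orbits of a permutation by size\<close>

text \<open>
  This is \<open>cycle_type\<close> for permutations of an arbitrary set. The generality serves the construction of
  permutations with prescribed cycle type, which splits off a cycle and recurses on what is left.
\<close>

definition orbit_count :: "('a \<Rightarrow> 'a) \<Rightarrow> 'a set \<Rightarrow> nat \<Rightarrow> nat" where
  "orbit_count f A k = card {C \<in> Orbits.orbit f ` A. card C = k}"

lemma cycle_type_eq_orbit_count: "cycle_type n \<sigma> = orbit_count \<sigma> {1..n}"
  by (simp add: cycle_type_def orbit_count_def fun_eq_iff)

lemma orbit_eq_of_mem:
  assumes "permutation f" "y \<in> Orbits.orbit f x"
  shows "Orbits.orbit f y = Orbits.orbit f x"
  using orbit_cyclic_eq3[OF cyclic_on_orbit'[OF assms(1)] assms(2)] .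

text \<open>
  The orbits partition \<open>A\<close>, and the sum counts the points of \<open>A\<close> grouped by orbit size. For
  \<open>A = K = {1..n}\<close> this makes the cycle type a partition of \<open>n\<close>.
\<close>

lemma sum_orbit_count:
  assumes "finite A" "f permutes A" "finite K"
    and K: "\<And>x. x \<in> A \<Longrightarrow> card (Orbits.orbit f x) \<in> K"
  shows "(\<Sum>k\<in>K. k * orbit_count f A k) = card A"
proof -
  have perm: "permutation f" using assms permutation_permutes by blast
  let ?O = "Orbits.orbit f ` A"
  have "\<Union>?O = A"
    using permutes_orbit_subset[OF assms(2)] permutation_self_in_orbit[OF perm] by blast
  moreover have "card (\<Union>?O) = sum card ?O"
  proof (rule card_Union_disjoint)
    show "disjoint ?O"
      unfolding pairwise_image pairwise_def disjnt_def using orbit_eq_of_mem[OF perm] by blast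
    show "\<And>C. C \<in> ?O \<Longrightarrow> finite C"
      using finite_orbit[OF permutation_self_in_orbit[OF perm]] by auto
  qed
  moreover have "sum card ?O = (\<Sum>k\<in>K. \<Sum>C\<in>{C \<in> ?O. card C = k}. card C)"
    using assms(1,3) K by (intro sum.group[symmetric]) auto
  moreover have "(\<Sum>C\<in>{C \<in> ?O. card C = k}. card C) = k * orbit_count f A k" for k
    by (simp add: orbit_count_def)
  ultimately show ?thesis by (simp only:)
qed

lemma card_orbit_bounds:
  assumes "finite A" "f permutes A" "x \<in> A"
  shows "card (Orbits.orbit f x) \<in> {1..card A}"
proof -
  have sub: "Orbits.orbit f x \<subseteq> A" by (rule permutes_orbit_subset[OF assms(2,3)])
  then have "card (Orbits.orbit f x) > 0"
    using assms(1) orbit_nonempty[of f x] finite_subset card_gt_0_iff by metis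
  then show ?thesis using card_mono[OF assms(1) sub] by simp
qed

section \<open>Permutations with the same orbit sizes are conjugate\<close>

text \<open>
  Which powers of \<open>f\<close> agree at \<open>x\<close> depends only on the size of the orbit of \<open>x\<close>. Hence, for two
  orbits of the same size, \<open>f\<^sup>a x \<mapsto> g\<^sup>a y\<close> is a well-defined injective map between them.
\<close>

lemma funpow_eq_iff_mod_card_orbit:
  assumes "permutation f"
  shows "(f ^^ a) x = (f ^^ b) x \<longleftrightarrow>
    a mod card (Orbits.orbit f x) = b mod card (Orbits.orbit f x)"
proof -
  have self: "x \<in> Orbits.orbit f x" by (rule permutation_self_in_orbit[OF assms])
  define k where "k = funpow_dist1 f x x"
  have inj: "inj_on (\<lambda>n. (f ^^ n) x) {0..<k}"
    unfolding k_def by (rule inj_on_funpow_dist1[OF self])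
  have "card (Orbits.orbit f x) = k"
    using orbit_conv_funpow_dist1[OF self] card_image[OF inj] by (simp add: k_def)
  moreover have "(f ^^ k) x = x" unfolding k_def by (rule funpow_dist1_prop[OF self])
  then have "(f ^^ (a mod k)) x = (f ^^ a) x" for a by (rule funpow_mod_eq)
  moreover have "a mod k \<in> {0..<k}" for a by (simp add: k_def)
  ultimately show ?thesis using inj unfolding inj_on_def by metis
qed

text \<open>
  Bijections between the fibres of the two weights combine to a bijection \<open>\<Psi>\<close>. To send \<open>a\<close> to \<open>b\<close>,
  it is followed by the transposition of \<open>\<Psi> a\<close> and \<open>b\<close>, two elements of equal weight.
\<close>

lemma weight_preserving_bijection:
  assumes "finite X" "finite Y"
    and count: "\<And>k. card {x \<in> X. v x = k} = card {y \<in> Y. w y = k}"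
    and a: "a \<in> X" and b: "b \<in> Y" and ab: "v a = w b"
  shows "\<exists>\<Phi>. bij_betw \<Phi> X Y \<and> (\<forall>x\<in>X. w (\<Phi> x) = v x) \<and> \<Phi> a = b"
proof -
  have "\<exists>h. bij_betw h {x \<in> X. v x = k} {y \<in> Y. w y = k}" for k
    using assms(1,2) count[of k] by (intro finite_same_card_bij) auto
  then obtain h where h: "\<And>k. bij_betw (h k) {x \<in> X. v x = k} {y \<in> Y. w y = k}"
    by metis
  define \<Psi> where "\<Psi> x = h (v x) x" for x
  have \<Psi>: "\<Psi> x \<in> Y \<and> w (\<Psi> x) = v x" if "x \<in> X" for x
    using bij_betwE[OF h[of "v x"]] that by (auto simp: \<Psi>_def)
  have inj: "inj_on \<Psi> X"
  proof (rule inj_onI)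
    fix x y assume xy: "x \<in> X" "y \<in> X" "\<Psi> x = \<Psi> y"
    then have "v x = v y" using \<Psi> by metis
    then show "x = y"
      using xy bij_betw_imp_inj_on[OF h[of "v x"]] by (auto simp: \<Psi>_def inj_on_def)
  qed
  have surj: "Y \<subseteq> \<Psi> ` X"
  proof
    fix y assume "y \<in> Y"
    then have "y \<in> h (w y) ` {x \<in> X. v x = w y}"
      using bij_betw_imp_surj_on[OF h[of "w y"]] by simp
    then obtain x where "x \<in> X" "y = \<Psi> x" by (auto simp: \<Psi>_def)
    then show "y \<in> \<Psi> ` X" by blast
  qed
  have bij: "bij_betw \<Psi> X Y" using inj surj \<Psi> by (auto simp: bij_betw_def)
  define t where "t = transpose (\<Psi> a) b"
  have "t permutes Y" using \<Psi>[OF a] b by (simp add: t_def permutes_swap_id)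
  then have "bij_betw (t \<circ> \<Psi>) X Y"
    using bij bij_betw_trans permutes_imp_bij by blast
  moreover have "w (t y) = w y" for y
    using \<Psi>[OF a] ab by (simp add: t_def transpose_def)
  then have "\<forall>x\<in>X. w ((t \<circ> \<Psi>) x) = v x" using \<Psi> by simp
  moreover have "(t \<circ> \<Psi>) a = b" by (simp add: t_def)
  ultimately show ?thesis by blast
qed

text \<open>
  A size-preserving bijection \<open>\<Phi>\<close> matches the orbits of \<open>f\<close> with those of \<open>g\<close>. After a base point
  \<open>r C\<close> is chosen in each orbit \<open>C\<close> and a base point \<open>s C\<close> in \<open>\<Phi> C\<close>, the conjugator is
  \<open>f\<^sup>a (r C) \<mapsto> g\<^sup>a (s C)\<close>. It takes \<open>x\<close> to \<open>y\<close> because \<open>\<Phi>\<close> matches their orbits and these two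
  points serve as base points there.
\<close>

lemma pointed_conjugator_exists:
  assumes fin: "finite A" and f: "f permutes A" and g: "g permutes A"
    and count: "\<And>k. orbit_count f A k = orbit_count g A k"
    and x: "x \<in> A" and y: "y \<in> A"
    and xy: "card (Orbits.orbit f x) = card (Orbits.orbit g y)"
  shows "\<exists>h. h permutes A \<and> h \<circ> f = g \<circ> h \<and> h x = y"
proof -
  have permf: "permutation f" and permg: "permutation g"
    using fin f g permutation_permutes by blast+
  note selff = permutation_self_in_orbit[OF permf]
  note selfg = permutation_self_in_orbit[OF permg]
  let ?orb = "Orbits.orbit f"
  obtain \<Phi> where bij: "bij_betw \<Phi> (?orb ` A) (Orbits.orbit g ` A)"
    and card: "\<And>C. C \<in> ?orb ` A \<Longrightarrow> card (\<Phi> C) = card C"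
    and \<Phi>x: "\<Phi> (?orb x) = Orbits.orbit g y"
    using weight_preserving_bijection[of "?orb ` A" "Orbits.orbit g ` A" card card "?orb x" "Orbits.orbit g y"]
      fin count x y xy by (auto simp: orbit_count_def)
  define r where "r C = (if C = ?orb x then x else SOME z. z \<in> C)" for C
  define s where "s C = (if C = ?orb x then y else SOME z. z \<in> \<Phi> C)" for C
  have r: "r (?orb z) \<in> ?orb z" for z
    using selff[of x] someI[of "\<lambda>u. u \<in> ?orb z", OF selff] by (auto simp: r_def)
  have orb_r: "?orb (r (?orb z)) = ?orb z" for z
    by (rule orbit_eq_of_mem[OF permf r])
  have orb_s: "Orbits.orbit g (s C) = \<Phi> C" if C: "C \<in> ?orb ` A" for C
  proof -
    obtain u where u: "\<Phi> C = Orbits.orbit g u" using bij_betwE[OF bij] C by blast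
    have "s C \<in> \<Phi> C"
      using someI[of "\<lambda>v. v \<in> \<Phi> C", of u] selfg[of u] selfg[of y] \<Phi>x u by (auto simp: s_def)
    then show ?thesis using orbit_eq_of_mem[OF permg] u by metis
  qed
  define t where "t z = funpow_dist f (r (?orb z)) z" for z
  have t: "(f ^^ t z) (r (?orb z)) = z" for z
    unfolding t_def by (rule funpow_dist_prop) (simp add: orb_r selff)
  \<comment> \<open>Read from left to right this makes \<open>h\<close> below equivariant; from right to left, injective.\<close>
  have transfer: "(f ^^ a) (r C) = (f ^^ b) (r C) \<longleftrightarrow> (g ^^ a) (s C) = (g ^^ b) (s C)"
    if C: "C \<in> ?orb ` A" for C a b
  proof -
    have "?orb (r C) = C" using C orb_r by auto
    then show ?thesis
      using orb_s[OF C] card[OF C]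
      by (simp add: funpow_eq_iff_mod_card_orbit[OF permf] funpow_eq_iff_mod_card_orbit[OF permg])
  qed
  define h where "h z = (if z \<in> A then (g ^^ t z) (s (?orb z)) else z)" for z
  have orb_h: "Orbits.orbit g (h z) = \<Phi> (?orb z)" if z: "z \<in> A" for z
  proof -
    have "h z \<in> Orbits.orbit g (s (?orb z))"
      using z funpow_in_orbit[OF selfg] by (simp add: h_def)
    then have "Orbits.orbit g (h z) = Orbits.orbit g (s (?orb z))"
      by (rule orbit_eq_of_mem[OF permg])
    also have "\<dots> = \<Phi> (?orb z)" using z by (intro orb_s imageI)
    finally show ?thesis .
  qed
  have hA: "h z \<in> A" if z: "z \<in> A" for z
  proof -
    have "\<Phi> (?orb z) \<in> Orbits.orbit g ` A" using bij_betwE[OF bij] z by blast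
    then obtain u where "u \<in> A" "Orbits.orbit g (h z) = Orbits.orbit g u"
      using orb_h[OF z] by auto
    then show ?thesis using selfg[of "h z"] permutes_orbit_subset[OF g] by blast
  qed
  have inj: "inj_on h A"
  proof (rule inj_onI)
    fix z w assume zw: "z \<in> A" "w \<in> A" "h z = h w"
    then have "\<Phi> (?orb z) = \<Phi> (?orb w)" using orb_h by metis
    then have eq: "?orb z = ?orb w"
      using bij_betw_imp_inj_on[OF bij] zw by (auto dest: inj_onD)
    have "(g ^^ t z) (s (?orb z)) = (g ^^ t w) (s (?orb z))"
      using zw eq by (simp add: h_def)
    then have "(f ^^ t z) (r (?orb z)) = (f ^^ t w) (r (?orb z))"
      using transfer zw(1) by blast
    then show "z = w" by (metis t eq)
  qed
  have "bij_betw h A A"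
    using inj hA fin by (simp add: bij_betw_def endo_inj_surj image_subsetI)
  then have perm: "h permutes A" by (rule bij_imp_permutes) (simp add: h_def)
  have "h (f z) = g (h z)" for z
  proof (cases "z \<in> A")
    case True
    have fz: "f z \<in> A" using True permutes_in_image[OF f] by simp
    have orb: "?orb (f z) = ?orb z" by (rule permutation_orbit_step[OF permf])
    have "(f ^^ t (f z)) (r (?orb z)) = f z"
      using t[of "f z"] by (simp only: orb)
    also have "\<dots> = (f ^^ Suc (t z)) (r (?orb z))"
      by (simp only: funpow.simps comp_apply t)
    finally have "(f ^^ t (f z)) (r (?orb z)) = (f ^^ Suc (t z)) (r (?orb z))" .
    then have "(g ^^ t (f z)) (s (?orb z)) = (g ^^ Suc (t z)) (s (?orb z))"
      using transfer True by blast
    then show ?thesis using True fz orb by (simp add: h_def)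
  next
    case False
    then show ?thesis by (simp add: h_def permutes_not_in[OF f] permutes_not_in[OF g])
  qed
  moreover have "h x = y"
    using x funpow_dist_0[of x x f] by (simp add: h_def t_def r_def s_def)
  ultimately show ?thesis using perm by (auto simp: fun_eq_iff)
qed

lemma conjugation_orbit:
  assumes "h permutes A" "finite A" "f permutes A" "h \<circ> f = g \<circ> h"
  shows "Orbits.orbit g (h x) = h ` Orbits.orbit f x"
proof (rule orbit_inverse[symmetric])
  show "x \<in> Orbits.orbit f x"
    using assms permutation_permutes permutation_self_in_orbit by metis
  show "g (h z) = h (f z)" for z using assms(4) by (simp add: fun_eq_iff)
qed

lemma orbit_count_conjugate:
  assumes h: "h permutes A" and "finite A" "f permutes A" "h \<circ> f = g \<circ> h"
  shows "orbit_count g A = orbit_count f A"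
proof
  fix k
  have inj: "inj h" by (rule permutes_inj[OF h])
  have "Orbits.orbit g ` A = Orbits.orbit g ` h ` A" by (simp add: permutes_image[OF h])
  also have "\<dots> = image h ` Orbits.orbit f ` A"
    by (simp add: image_image conjugation_orbit[OF assms])
  finally have "{C \<in> Orbits.orbit g ` A. card C = k}
      = image h ` {C \<in> Orbits.orbit f ` A. card C = k}"
    using card_image[OF inj_on_subset[OF inj subset_UNIV]] by auto
  moreover have "inj (image h)" using inj by (simp add: inj_image_eq_iff inj_def)
  ultimately show "orbit_count g A k = orbit_count f A k"
    by (simp add: orbit_count_def card_image inj_on_subset)
qed

section \<open>Every partition is a cycle type\<close>

text \<open>The cycle through an enumeration of \<open>B\<close>.\<close>

lemma cyclic_permutation_exists:
  assumes "finite B"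
  shows "\<exists>c. c permutes B \<and> (\<forall>x\<in>B. Orbits.orbit c x = B)"
proof (cases "B = {}")
  case True
  then show ?thesis using permutes_id by blast
next
  case False
  obtain cs where cs: "set cs = B" "distinct cs" using finite_distinct_list[OF assms] by blast
  define c where "c = cycle_of_list cs"
  have ne: "cs \<noteq> []" using cs False by auto
  have perm: "c permutes B" using cycle_permutes[of cs] cs by (simp add: c_def)
  have pow: "(c ^^ i) (cs ! 0) = cs ! i" if "i < length cs" for i
  proof -
    have "map (c ^^ i) cs ! 0 = rotate i cs ! 0"
      using cyclic_rotation[OF cs(2)] by (simp add: c_def)
    then show ?thesis using that ne by (simp add: nth_rotate)
  qed
  have hd: "cs ! 0 \<in> B" using ne cs nth_mem by blast
  have "B \<subseteq> Orbits.orbit c (cs ! 0)"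
  proof
    fix b assume "b \<in> B"
    then obtain i where i: "i < length cs" "b = cs ! i" using cs by (metis in_set_conv_nth)
    have "permutation c" using perm assms permutation_permutes by blast
    then have "(c ^^ i) (cs ! 0) \<in> Orbits.orbit c (cs ! 0)"
      by (intro funpow_in_orbit permutation_self_in_orbit)
    then show "b \<in> Orbits.orbit c (cs ! 0)" using i pow by simp
  qed
  then have "Orbits.orbit c (cs ! 0) = B"
    using permutes_orbit_subset[OF perm hd] by blast
  then have "cyclic_on c B" using hd by (metis cyclic_on_def)
  then have "\<forall>x\<in>B. Orbits.orbit c x = B" by (simp add: orbit_cyclic_eq3)
  then show ?thesis using perm by blast
qed

lemma orbit_count_add_cycle:
  assumes fin: "finite A" and BA: "B \<subseteq> A" and ne: "B \<noteq> {}"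
    and c: "c permutes B" and cB: "\<And>x. x \<in> B \<Longrightarrow> Orbits.orbit c x = B"
    and p: "p permutes (A - B)"
  shows "(c \<circ> p) permutes A"
    and "orbit_count (c \<circ> p) A = (orbit_count p (A - B))(card B := Suc (orbit_count p (A - B) (card B)))"
proof -
  show perm: "(c \<circ> p) permutes A"
    using permutes_compose[OF permutes_subset[OF p] permutes_subset[OF c BA]] by auto
  have inB: "Orbits.orbit (c \<circ> p) x = B" if "x \<in> B" for x
  proof -
    have "Orbits.orbit (c \<circ> p) x = Orbits.orbit c x"
    proof (rule orbit_cong0[OF that])
      show "c \<circ> p \<in> B \<rightarrow> B"
        by (auto simp: permutes_not_in[OF p] permutes_in_image[OF c])
      show "\<And>y. y \<in> B \<Longrightarrow> (c \<circ> p) y = c y" by (simp add: permutes_not_in[OF p])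
    qed
    then show ?thesis using cB that by simp
  qed
  have inAB: "Orbits.orbit (c \<circ> p) x = Orbits.orbit p x" if "x \<in> A - B" for x
  proof (rule orbit_cong0[OF that])
    have *: "(c \<circ> p) y = p y" if "y \<in> A - B" for y
    proof -
      have "p y \<in> A - B" using that by (simp only: permutes_in_image[OF p])
      then show ?thesis by (simp add: permutes_not_in[OF c])
    qed
    then show "\<And>y. y \<in> A - B \<Longrightarrow> (c \<circ> p) y = p y" .
    show "c \<circ> p \<in> A - B \<rightarrow> A - B"
      using * permutes_in_image[OF p] by fastforce
  qed
  let ?P = "Orbits.orbit p ` (A - B)"
  have orbits: "Orbits.orbit (c \<circ> p) ` A = insert B ?P"
  proof -
    have "A = B \<union> (A - B)" using BA by blast
    then have "Orbits.orbit (c \<circ> p) ` A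
        = Orbits.orbit (c \<circ> p) ` B \<union> Orbits.orbit (c \<circ> p) ` (A - B)"
      by (metis image_Un)
    also have "Orbits.orbit (c \<circ> p) ` B = {B}" using inB ne by auto
    also have "Orbits.orbit (c \<circ> p) ` (A - B) = ?P" using inAB by auto
    finally show ?thesis by (simp only: insert_is_Un[symmetric])
  qed
  have nB: "B \<notin> ?P"
    using permutes_orbit_subset[OF p] ne by blast
  have "{C \<in> insert B ?P. card C = card B} = insert B {C \<in> ?P. card C = card B}" by auto
  then have "card {C \<in> insert B ?P. card C = card B} = Suc (card {C \<in> ?P. card C = card B})"
    using nB fin by simp
  moreover have "{C \<in> insert B ?P. card C = k} = {C \<in> ?P. card C = k}" if "k \<noteq> card B" for k
    using that by auto
  ultimately show "orbit_count (c \<circ> p) A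
      = (orbit_count p (A - B))(card B := Suc (orbit_count p (A - B) (card B)))"
    by (auto simp: fun_eq_iff orbit_count_def orbits)
qed

text \<open>
  Some \<open>d\<close> has positive multiplicity unless \<open>A\<close> is empty. A \<open>d\<close>-element subset \<open>B\<close> of \<open>A\<close> carries a
  single cycle, and the induction hypothesis for \<open>A - B\<close>, with the multiplicity of \<open>d\<close> lowered by one,
  supplies the other cycles. As \<open>0 \<notin> K\<close>, the set \<open>B\<close> is nonempty and \<open>A - B\<close> is smaller than \<open>A\<close>.
\<close>

lemma permutation_with_orbit_count_exists:
  assumes "finite A" "finite K" "0 \<notin> K"
    and "\<And>k. k \<notin> K \<Longrightarrow> m k = 0"
    and "(\<Sum>k\<in>K. k * m k) = card A"
  shows "\<exists>f. f permutes A \<and> orbit_count f A = m"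
  using assms(1,4,5)
proof (induction A arbitrary: m rule: finite_psubset_induct)
  case (psubset A)
  show ?case
  proof (cases "\<exists>k. m k > 0")
    case False
    then have m: "m = (\<lambda>_. 0)" by auto
    then have "A = {}" using psubset by simp
    then show ?thesis
      using m permutes_id[of "{}"] by (auto simp: orbit_count_def intro!: exI[of _ id])
  next
    case True
    then obtain d where d: "m d > 0" by blast
    have dK: "d \<in> K" using d psubset.prems(1) by force
    have d0: "d > 0" using dK assms(3) by (cases d) auto
    define m' where "m' = m(d := m d - 1)"
    have split: "(\<Sum>k\<in>K. k * u k) = d * u d + (\<Sum>k\<in>K - {d}. k * u k)" for u :: "nat \<Rightarrow> nat"
      using sum.remove[OF assms(2) dK] by blast
    have rest: "(\<Sum>k\<in>K - {d}. k * m' k) = (\<Sum>k\<in>K - {d}. k * m k)"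
      by (rule sum.cong) (auto simp: m'_def)
    have "d * m d = d + d * m' d" using d by (cases "m d") (auto simp: m'_def)
    then have sum: "d + (\<Sum>k\<in>K. k * m' k) = card A"
      using psubset.prems(2) split[of m] split[of m'] rest by simp
    then obtain B where B: "B \<subseteq> A" "card B = d"
      using obtain_subset_with_card_n[of d A] by auto
    have finB: "finite B" using B psubset.hyps finite_subset by blast
    have ne: "B \<noteq> {}" using B d0 by auto
    have "(\<Sum>k\<in>K. k * m' k) = card (A - B)"
      using sum card_Diff_subset[OF finB B(1)] B(2) by simp
    moreover have "A - B \<subset> A" using B ne by blast
    moreover have "m' k = 0" if "k \<notin> K" for k using that psubset.prems(1) dK by (auto simp: m'_def)
    ultimately obtain p where p: "p permutes (A - B)" "orbit_count p (A - B) = m'"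
      using psubset.IH by blast
    obtain c where c: "c permutes B" "\<And>x. x \<in> B \<Longrightarrow> Orbits.orbit c x = B"
      using cyclic_permutation_exists[OF finB] by blast
    have "m'(d := Suc (m' d)) = m" using d by (auto simp: m'_def)
    then show ?thesis
      using orbit_count_add_cycle[OF psubset.hyps B(1) ne c p(1)] p(2) B(2) by auto
  qed
qed

section \<open>The components of the quandle\<close>

lemma mem_QS: "(i, \<sigma>) \<in> QS n \<longleftrightarrow> i \<in> {1..n} \<and> \<sigma> permutes {1..n}"
  by (simp add: QS_def sym_group_def)

lemma QS_op_eq: "QS_op (i, \<sigma>) (j, \<tau>) = (\<tau> (inv_into UNIV \<sigma> i), \<tau> \<circ> \<sigma> \<circ> inv_into UNIV \<tau>)"
  by (simp add: QS_op_def lr_mult_def o_assoc)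

definition cycle_data :: "nat \<Rightarrow> nat \<times> (nat \<Rightarrow> nat) \<Rightarrow> (nat \<Rightarrow> nat) \<times> nat" where
  "cycle_data n = (\<lambda>(i, \<sigma>). (cycle_type n \<sigma>, cycle_length i \<sigma>))"

lemma cycle_data_QS_op:
  assumes "x \<in> QS n" "y \<in> QS n"
  shows "cycle_data n (QS_op x y) = cycle_data n x"
proof -
  obtain i \<sigma> j \<tau> where xy: "x = (i, \<sigma>)" "y = (j, \<tau>)" by (cases x; cases y)
  have \<sigma>: "\<sigma> permutes {1..n}" and \<tau>: "\<tau> permutes {1..n}" using assms by (auto simp: xy mem_QS)
  define \<rho> where "\<rho> = \<tau> \<circ> \<sigma> \<circ> inv_into UNIV \<tau>"
  have conj: "\<tau> \<circ> \<sigma> = \<rho> \<circ> \<tau>"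
    by (simp add: \<rho>_def comp_assoc permutes_inv_o(2)[OF \<tau>])
  have perm: "permutation \<sigma>" using \<sigma> permutation_permutes by blast
  have "Orbits.orbit \<sigma> (inv_into UNIV \<sigma> i) = Orbits.orbit \<sigma> i"
    using permutation_orbit_step[OF perm, of "inv_into UNIV \<sigma> i"] by (simp add: permutes_inverses[OF \<sigma>])
  then have "Orbits.orbit \<rho> (\<tau> (inv_into UNIV \<sigma> i)) = \<tau> ` Orbits.orbit \<sigma> i"
    using conjugation_orbit[OF \<tau> _ \<sigma> conj] by simp
  then have "card (Orbits.orbit \<rho> (\<tau> (inv_into UNIV \<sigma> i))) = card (Orbits.orbit \<sigma> i)"
    by (simp add: card_image inj_on_subset[OF permutes_inj[OF \<tau>]])
  moreover have "orbit_count \<rho> {1..n} = orbit_count \<sigma> {1..n}"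
    by (rule orbit_count_conjugate[OF \<tau> _ \<sigma> conj]) simp
  ultimately show ?thesis
    by (simp add: xy QS_op_eq cycle_data_def cycle_length_def cycle_type_eq_orbit_count \<rho>_def)
qed

text \<open>
  For \<open>x = (i, \<sigma>)\<close> and \<open>x' = (k, \<rho>)\<close>, take \<open>h\<close> that conjugates \<open>\<sigma>\<close> to \<open>\<rho>\<close> and maps \<open>i\<close> to \<open>k\<close>. The
  symmetry at \<open>(i, h)\<close> would give the right permutation but the index \<open>h (\<sigma>\<inverse> i)\<close>. Replacing \<open>h\<close> by
  \<open>h \<circ> \<sigma>\<close> corrects the index and gives the same conjugate.
\<close>

lemma QS_op_transitive_on_cycle_data:
  assumes "x \<in> QS n" "x' \<in> QS n" "cycle_data n x = cycle_data n x'"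
  shows "\<exists>y\<in>QS n. QS_op x y = x'"
proof -
  obtain i \<sigma> k \<rho> where xx: "x = (i, \<sigma>)" "x' = (k, \<rho>)" by (cases x; cases x')
  have i: "i \<in> {1..n}" and \<sigma>: "\<sigma> permutes {1..n}" and k: "k \<in> {1..n}" and \<rho>: "\<rho> permutes {1..n}"
    using assms by (auto simp: xx mem_QS)
  obtain h where h: "h permutes {1..n}" "h \<circ> \<sigma> = \<rho> \<circ> h" "h i = k"
    using pointed_conjugator_exists[OF _ \<sigma> \<rho> _ i k] assms(3)
    by (auto simp: xx cycle_data_def cycle_type_eq_orbit_count cycle_length_def)
  define \<tau> where "\<tau> = h \<circ> \<sigma>"
  have \<tau>: "\<tau> permutes {1..n}" unfolding \<tau>_def by (rule permutes_compose[OF \<sigma> h(1)])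
  have "\<tau> (inv_into UNIV \<sigma> i) = k"
    unfolding \<tau>_def comp_apply permutes_inverses(1)[OF \<sigma>] by (rule h(3))
  moreover have "\<tau> \<circ> \<sigma> \<circ> inv_into UNIV \<tau> = \<rho>"
  proof -
    have "\<tau> \<circ> \<sigma> = \<rho> \<circ> \<tau>" using h(2) by (simp add: \<tau>_def comp_assoc)
    then show ?thesis by (simp add: comp_assoc permutes_inv_o(1)[OF \<tau>])
  qed
  ultimately have "QS_op x (i, \<tau>) = x'" by (simp add: xx QS_op_eq)
  moreover have "(i, \<tau>) \<in> QS n" using i \<tau> by (simp add: mem_QS)
  ultimately show ?thesis by blast
qed

lemma cycle_data_image: "cycle_data n ` QS n = (SIGMA m : partitions n. supp n m)"
proof
  show "cycle_data n ` QS n \<subseteq> (SIGMA m : partitions n. supp n m)"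
  proof
    fix z assume "z \<in> cycle_data n ` QS n"
    then obtain i \<sigma> where i: "i \<in> {1..n}" and \<sigma>: "\<sigma> permutes {1..n}"
      and z: "z = (cycle_type n \<sigma>, cycle_length i \<sigma>)"
      by (auto simp: cycle_data_def mem_QS)
    have bounds: "card (Orbits.orbit \<sigma> j) \<in> {1..n}" if "j \<in> {1..n}" for j
      using card_orbit_bounds[OF _ \<sigma> that] by simp
    then have "(\<Sum>k\<in>{1..n}. k * orbit_count \<sigma> {1..n} k) = n"
      using sum_orbit_count[OF _ \<sigma>, of "{1..n}"] by simp
    moreover have "orbit_count \<sigma> {1..n} k = 0" if "k \<notin> {1..n}" for k
    proof -
      have "{C \<in> Orbits.orbit \<sigma> ` {1..n}. card C = k} = {}" using bounds that by blast
      then show ?thesis by (simp only: orbit_count_def card.empty)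
    qed
    ultimately have "cycle_type n \<sigma> \<in> partitions n"
      by (simp add: partitions_def cycle_type_eq_orbit_count)
    moreover have "cycle_length i \<sigma> \<in> supp n (cycle_type n \<sigma>)"
      using bounds[OF i] i
      by (auto simp: supp_def cycle_length_def cycle_type_def card_gt_0_iff)
    ultimately show "z \<in> (SIGMA m : partitions n. supp n m)" by (simp add: z)
  qed
next
  show "(SIGMA m : partitions n. supp n m) \<subseteq> cycle_data n ` QS n"
  proof clarify
    fix m d assume m: "m \<in> partitions n" and d: "d \<in> supp n m"
    have "\<exists>\<sigma>. \<sigma> permutes {1..n} \<and> orbit_count \<sigma> {1..n} = m"
      using m by (intro permutation_with_orbit_count_exists[of _ "{1..n}"]) (auto simp: partitions_def)
    then obtain \<sigma> where \<sigma>: "\<sigma> permutes {1..n}" "cycle_type n \<sigma> = m"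
      by (auto simp: cycle_type_eq_orbit_count)
    have "card {C \<in> Orbits.orbit \<sigma> ` {1..n}. card C = d} > 0"
      using d \<sigma>(2) by (auto simp: supp_def cycle_type_def)
    then obtain i where i: "i \<in> {1..n}" "cycle_length i \<sigma> = d"
      by (auto simp: card_gt_0_iff cycle_length_def)
    have "(m, d) = cycle_data n (i, \<sigma>)" using i \<sigma> by (simp add: cycle_data_def)
    then show "(m, d) \<in> cycle_data n ` QS n" using i \<sigma> by (simp add: mem_QS)
  qed
qed

theorem corollary4p5:
  fixes n :: nat
  assumes "n > 0"
  shows "\<pi>\<^sub>0 (QS n) QS_op = {\<Omega> n m d | m d. m \<in> partitions n \<and> d \<in> supp n m}
    \<and> (\<exists>F. bij_betw F (\<pi>\<^sub>0 (QS n) QS_op) (SIGMA m : partitions n. supp n m)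
          \<and> (\<forall>(i, \<sigma>) \<in> QS n. F (component (QS n) QS_op (i, \<sigma>)) = (cycle_type n \<sigma>, cycle_length i \<sigma>)))"
proof
  have fibre: "component (QS n) QS_op q = {x \<in> QS n. cycle_data n x = cycle_data n q}"
    if "q \<in> QS n" for q
  proof (rule quandle.component_eq_fibre[where c = "cycle_data n", OF quandle_QS])
    show "cycle_data n (QS_op x y) = cycle_data n x" if "x \<in> QS n" "y \<in> QS n" for x y
      using that by (rule cycle_data_QS_op)
    show "\<exists>y\<in>QS n. QS_op x y = x'"
      if "x \<in> QS n" "x' \<in> QS n" "cycle_data n x = cycle_data n x'" for x x'
      using that by (rule QS_op_transitive_on_cycle_data)
  qed (rule that)
  have \<Omega>: "\<Omega> n m d = {x \<in> QS n. cycle_data n x = (m, d)}" for m d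
    by (auto simp: \<Omega>_def QS_def cycle_data_def)
  have "\<pi>\<^sub>0 (QS n) QS_op = (\<lambda>(m, d). \<Omega> n m d) ` cycle_data n ` QS n"
    unfolding \<pi>\<^sub>0_def image_image
    by (rule image_cong) (auto simp: fibre \<Omega> split: prod.split)
  also have "\<dots> = {\<Omega> n m d | m d. m \<in> partitions n \<and> d \<in> supp n m}"
    unfolding cycle_data_image by auto
  finally show "\<pi>\<^sub>0 (QS n) QS_op = {\<Omega> n m d | m d. m \<in> partitions n \<and> d \<in> supp n m}" .
  show "\<exists>F. bij_betw F (\<pi>\<^sub>0 (QS n) QS_op) (SIGMA m : partitions n. supp n m)
      \<and> (\<forall>(i, \<sigma>) \<in> QS n. F (component (QS n) QS_op (i, \<sigma>)) = (cycle_type n \<sigma>, cycle_length i \<sigma>))"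
  proof -
    obtain F where "bij_betw F (\<pi>\<^sub>0 (QS n) QS_op) (SIGMA m : partitions n. supp n m)"
      and F: "\<forall>q\<in>QS n. F (component (QS n) QS_op q) = cycle_data n q"
      using \<pi>\<^sub>0_bij_betw_invariant_values[of "QS n" QS_op "cycle_data n", OF fibre]
      unfolding cycle_data_image by blast
    moreover have "\<forall>(i, \<sigma>) \<in> QS n. F (component (QS n) QS_op (i, \<sigma>)) = (cycle_type n \<sigma>, cycle_length i \<sigma>)"
      using F by (simp add: cycle_data_def split_beta)
    ultimately show ?thesis by blast
  qed
qed

end
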